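(* Let $\mathbf H$ be either $\mathbf Z$ or $\mathbf N$, let $a,b,c\in\mathbf H$ be fixed, and set $X:=\{ax^2+bxy+cy^2:x,y\in\mathbf H\}$ and $D:=b^2-4ac$. Then: (i) If $D$ is not a perfect square or $D=0$, then $X$ is small. (ii) If $D$ is a non-zero perfect square and either $ac=0$ or $\mathbf H=\mathbf Z$, then $\mu^\ast(X)>0$ for every upper quasi-density $\mu^\ast$ on $\mathbf H$.
   Context: $\mathbf N=\{0,1,2,\dots\}$, $\mathbf N^+=\mathbf N\setminus\{0\}$. For $X\subseteq\mathbf H$, $k\in\mathbf N^+$, $h\in\mathbf N$ write $k\cdot X+h:=\{kx+h:x\in X\}$. An upper quasi-density on $\mathbf H$ is a function $\mu^\ast:\mathcal P(\mathbf H)\to\mathbf R$ such that for all $X,Y\subseteq\mathbf H$, $k\in\mathbf N^+$, $h\in\mathbf N$: $\mu^\ast(X)\le 1$, $\mu^\ast(\mathbf H)=1$, $\mu^\ast(X\cup Y)\le\mu^\ast(X)+\mu^\ast(Y)$, $\mu^\ast(k\cdot X)=\frac1k\mu^\ast(X)$, and $\mu^\ast(X+h)=\mu^\ast(X)$. A set $X\subseteq\mathbf H$ is small if $\mu^\ast(X)=0$ for every upper quasi-density $\mu^\ast$ on $\mathbf H$. *)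

theory Defs
  imports "HOL-Analysis.Analysis" "HOL-Computational_Algebra.Nth_Powers"
begin

(* Both choices of the ground set H are modelled as sets of integers, namely UNIV for Z and {0..}
   for N.  A map from the power set of H to the reals is a total function int set => real,
   constrained only on (and only ever applied to) subsets of H. *)

definition affine_image :: "nat \<Rightarrow> int set \<Rightarrow> nat \<Rightarrow> int set" where
  "affine_image k X h = {int k * x + int h | x. x \<in> X}"

definition upper_quasi_density :: "int set \<Rightarrow> (int set \<Rightarrow> real) \<Rightarrow> bool" where
  "upper_quasi_density H \<mu> \<longleftrightarrow>
     (\<forall>X. X \<subseteq> H \<longrightarrow> \<mu> X \<le> 1) \<and>
     \<mu> H = 1 \<and>
     (\<forall>X Y. X \<subseteq> H \<longrightarrow> Y \<subseteq> H \<longrightarrow> \<mu> (X \<union> Y) \<le> \<mu> X + \<mu> Y) \<and>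
     (\<forall>X k. X \<subseteq> H \<longrightarrow> k > 0 \<longrightarrow> \<mu> (affine_image k X 0) = 1 / real k * \<mu> X) \<and>
     (\<forall>X h. X \<subseteq> H \<longrightarrow> \<mu> (affine_image 1 X h) = \<mu> X)"

definition small :: "int set \<Rightarrow> int set \<Rightarrow> bool" where
  "small H X \<longleftrightarrow> X \<subseteq> H \<and> (\<forall>\<mu>. upper_quasi_density H \<mu> \<longrightarrow> \<mu> X = 0)"

end

theory Submission
  imports Defs "HOL-Number_Theory.Residues" "HOL-Computational_Algebra.Squarefree"
begin

text \<open>
  If X meets r residue classes modulo k, then splitting X along these classes gives
  \<mu> X \<le> r / k. So X is small as soon as p | n implies p^2 | n for all n in X and all
  primes p in a set P with divergent sum of reciprocals: modulo p^2 the set X misses p - 1 classes.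
  For nonsquare D one takes for P the primes modulo which D is a nonresidue.

  Divergence of the sum of 1/p over these primes is proved by counting. By Thue's pigeonhole argument,
  the pairs (u,v) with uv squarefree, composed of primes that split, and uv < N^2 correspond,
  boundedly many to one, to vectors (x,y) of size at most N for which x^2 - Dy^2 is a small nonzero
  multiple of uv; there are O(N^2) of these. Hence the sum of 1/(uv) over the pairs with
  uv < 4^J is O(J), and T(J), the sum of 1/s over the squarefree products s < 2^J of split
  primes, is O(sqrt J). If the remaining primes had a convergent sum of reciprocals, the harmonic sum up to
  2^J, which is of order J, would be O(T(J)).

  In case (ii), X contains an arithmetic progression (in N, also 0), so finitely many shifts
  of X cover H.
\<close>

subsection \<open>Upper quasi-densities and residue classes\<close>

lemma affine_image_subset:
  assumes "H = UNIV \<or> H = {0..}" and "X \<subseteq> H"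
  shows "affine_image k X h \<subseteq> H"
  using assms by (auto simp: affine_image_def)

lemma upper_quasi_density_affine_image:
  assumes \<mu>: "upper_quasi_density H \<mu>" and H: "H = UNIV \<or> H = {0..}"
    and X: "X \<subseteq> H" and k: "k > 0"
  shows "\<mu> (affine_image k X h) = \<mu> X / real k"
proof -
  have "affine_image k X h = affine_image 1 (affine_image k X 0) h"
    by (auto simp: affine_image_def)
  moreover have "affine_image k X 0 \<subseteq> H"
    using affine_image_subset[OF H X] .
  ultimately show ?thesis
    using \<mu> X k by (simp add: upper_quasi_density_def)
qed

lemma upper_quasi_density_nonneg:
  assumes "upper_quasi_density H \<mu>" and "X \<subseteq> H"
  shows "\<mu> X \<ge> 0"
proof -
  have "\<mu> (X \<union> X) \<le> \<mu> X + \<mu> X"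
    using assms unfolding upper_quasi_density_def by blast
  then show ?thesis by simp
qed

lemma upper_quasi_density_empty:
  assumes "upper_quasi_density H \<mu>"
  shows "\<mu> {} = 0"
proof -
  have "\<mu> (affine_image 2 {} 0) = 1 / real 2 * \<mu> {}"
    using assms unfolding upper_quasi_density_def by (metis empty_subsetI zero_less_numeral)
  then show ?thesis by (simp add: affine_image_def)
qed

lemma upper_quasi_density_UN:
  assumes \<mu>: "upper_quasi_density H \<mu>" and "finite I" and "\<And>i. i \<in> I \<Longrightarrow> A i \<subseteq> H"
  shows "\<mu> (\<Union>i\<in>I. A i) \<le> (\<Sum>i\<in>I. \<mu> (A i))"
  using assms(2,3)
proof (induction I rule: finite_induct)
  case empty
  then show ?case using upper_quasi_density_empty[OF \<mu>] by simp
next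
  case (insert i I)
  have "A i \<subseteq> H" "(\<Union>i\<in>I. A i) \<subseteq> H" using insert.prems by auto
  then have "\<mu> (A i \<union> (\<Union>i\<in>I. A i)) \<le> \<mu> (A i) + \<mu> (\<Union>i\<in>I. A i)"
    using \<mu> unfolding upper_quasi_density_def by blast
  with insert show ?case by simp
qed

text \<open>Subadditivity and shift invariance give 1 \<le> m * \<mu> X. Positivity in case (ii)
  thus reduces to covering \<open>H\<close> by finitely many shifts.\<close>

lemma upper_quasi_density_pos_if_shifts_cover:
  assumes \<mu>: "upper_quasi_density H \<mu>" and H: "H = UNIV \<or> H = {0..}" and X: "X \<subseteq> H"
    and cover: "\<And>n. n \<in> H \<Longrightarrow> \<exists>h<m. n - int h \<in> X"
  shows "\<mu> X > 0"
proof -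
  have "H = (\<Union>h<m. affine_image 1 X h)"
  proof
    show "H \<subseteq> (\<Union>h<m. affine_image 1 X h)"
    proof
      fix n assume "n \<in> H"
      then obtain h where "h < m" "n - int h \<in> X" using cover by blast
      moreover have "n = int 1 * (n - int h) + int h" by simp
      ultimately show "n \<in> (\<Union>h<m. affine_image 1 X h)"
        unfolding affine_image_def by blast
    qed
    show "(\<Union>h<m. affine_image 1 X h) \<subseteq> H"
      using affine_image_subset[OF H X] by blast
  qed
  then have "\<mu> H \<le> (\<Sum>h<m. \<mu> (affine_image 1 X h))"
    using upper_quasi_density_UN[OF \<mu>, of "{..<m}" "affine_image 1 X"] affine_image_subset[OF H X]
    by simp
  also have "\<dots> = real m * \<mu> X"
    using upper_quasi_density_affine_image[OF \<mu> H X, of 1] by simp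
  finally have "1 \<le> real m * \<mu> X"
    using \<mu> by (simp add: upper_quasi_density_def)
  then show ?thesis
    using upper_quasi_density_nonneg[OF \<mu> X] by (cases "\<mu> X = 0") auto
qed

section \<open>Sieving by residue classes\<close>

definition residue_count :: "nat \<Rightarrow> int set \<Rightarrow> nat" where
  "residue_count k X = card ((\<lambda>x. x mod int k) ` X)"

lemma finite_residues:
  assumes "k > 0"
  shows "finite ((\<lambda>x. x mod int k) ` X)"
  by (rule finite_subset[of _ "{0..<int k}"]) (use assms in auto)

text \<open>The part of \<open>X\<close> in one residue class is an affine image of a subset of
  \<open>H\<close>, so scaling and shift invariance bound its share by 1 / k, whatever the
  class.\<close>

lemma upper_quasi_density_le_residue_count:
  assumes \<mu>: "upper_quasi_density H \<mu>" and H: "H = UNIV \<or> H = {0..}"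
    and X: "X \<subseteq> H" and k: "k > 0"
  shows "\<mu> X \<le> real (residue_count k X) / real k"
proof -
  define R where "R = (\<lambda>x. x mod int k) ` X"
  define Y where "Y r = {y \<in> H. int k * y + r \<in> X}" for r
  have Y: "Y r \<subseteq> H" for r by (auto simp: Y_def)
  have R: "r = int (nat r)" if "r \<in> R" for r
    using that k by (auto simp: R_def)
  have div: "x div int k \<in> H" if "x \<in> X" for x
    using that X H k by (auto simp: pos_imp_zdiv_nonneg_iff)
  have "X = (\<Union>r\<in>R. affine_image k (Y r) (nat r))"
  proof
    show "X \<subseteq> (\<Union>r\<in>R. affine_image k (Y r) (nat r))"
    proof
      fix x assume x: "x \<in> X"
      then have r: "x mod int k \<in> R" by (auto simp: R_def)
      have "x = int k * (x div int k) + int (nat (x mod int k))"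
        using R[OF r] by simp
      moreover have "x div int k \<in> Y (x mod int k)"
        using div[OF x] x by (simp add: Y_def)
      ultimately show "x \<in> (\<Union>r\<in>R. affine_image k (Y r) (nat r))"
        using r unfolding affine_image_def by blast
    qed
    show "(\<Union>r\<in>R. affine_image k (Y r) (nat r)) \<subseteq> X"
      using R by (auto simp: affine_image_def Y_def)
  qed
  then have "\<mu> X \<le> (\<Sum>r\<in>R. \<mu> (affine_image k (Y r) (nat r)))"
    using upper_quasi_density_UN[OF \<mu>, of R "\<lambda>r. affine_image k (Y r) (nat r)"]
      affine_image_subset[OF H Y] finite_residues[OF k, of X] by (simp add: R_def)
  also have "\<dots> \<le> (\<Sum>r\<in>R. 1 / real k)"
  proof (rule sum_mono)
    fix r
    have "\<mu> (Y r) \<le> 1" using \<mu> Y[of r] by (simp add: upper_quasi_density_def)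
    then show "\<mu> (affine_image k (Y r) (nat r)) \<le> 1 / real k"
      using upper_quasi_density_affine_image[OF \<mu> H Y k] k by (simp add: divide_right_mono)
  qed
  finally show ?thesis by (simp add: R_def residue_count_def)
qed

text \<open>By the Chinese remainder theorem, a residue modulo \<open>k * l\<close> is fixed by its
  residues modulo \<open>k\<close> and \<open>l\<close>.\<close>

lemma residue_count_mult_le:
  assumes "coprime k l" and "k > 0" and "l > 0"
  shows "residue_count (k * l) X \<le> residue_count k X * residue_count l X"
proof -
  let ?f = "\<lambda>r. (r mod int k, r mod int l)"
  let ?A = "(\<lambda>x. x mod int (k * l)) ` X"
  have "inj_on ?f ?A"
  proof (rule inj_onI)
    fix r s assume "r \<in> ?A" "s \<in> ?A" and eq: "?f r = ?f s"
    then have rs: "r mod int (k * l) = r" "s mod int (k * l) = s" by auto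
    have "[r = s] (mod int k)" "[r = s] (mod int l)" using eq by (simp_all add: cong_def)
    then have "[r = s] (mod (int k * int l))"
      using assms(1) by (intro coprime_cong_mult) auto
    with rs show "r = s" by (simp add: cong_def)
  qed
  moreover have "?f ` ?A \<subseteq> (\<lambda>x. x mod int k) ` X \<times> (\<lambda>x. x mod int l) ` X"
    by (auto simp: mod_mult2_eq mod_mod_cancel)
  ultimately have "card ?A \<le> card ((\<lambda>x. x mod int k) ` X \<times> (\<lambda>x. x mod int l) ` X)"
    using finite_residues[OF assms(2)] finite_residues[OF assms(3)]
    by (intro card_inj_on_le[where f = ?f]) auto
  then show ?thesis by (simp add: residue_count_def card_cartesian_product)
qed

lemma residue_count_prod_le:
  assumes "finite P" and "\<And>p. p \<in> P \<Longrightarrow> f p > 0"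
    and "\<And>p q. p \<in> P \<Longrightarrow> q \<in> P \<Longrightarrow> p \<noteq> q \<Longrightarrow> coprime (f p) (f q)"
  shows "residue_count (\<Prod>p\<in>P. f p) X \<le> (\<Prod>p\<in>P. residue_count (f p) X)"
  using assms
proof (induction P rule: finite_induct)
  case empty
  have "(\<lambda>x. x mod int 1) ` X \<subseteq> {0}" by auto
  then have "card ((\<lambda>x. x mod int 1) ` X) \<le> card {0::int}" by (intro card_mono) auto
  then show ?case by (simp add: residue_count_def)
next
  case (insert p P)
  have "coprime (f p) (\<Prod>p\<in>P. f p)"
    using insert.prems insert.hyps by (intro prod_coprime_right) auto
  then have "residue_count (f p * (\<Prod>p\<in>P. f p)) X \<le> residue_count (f p) X * residue_count (\<Prod>p\<in>P. f p) X"
    using insert.prems by (intro residue_count_mult_le prod_pos) auto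
  also have "\<dots> \<le> residue_count (f p) X * (\<Prod>p\<in>P. residue_count (f p) X)"
    using insert by (intro mult_left_mono) auto
  finally show ?case using insert.hyps by simp
qed

text \<open>The hypothesis rules out the p - 1 residues that are nonzero multiples of p. The missing
  proportion (p - 1) / p^2 is at least 1 / (2p) because p \<ge> 2.\<close>

lemma residue_count_prime_square_le:
  assumes p: "prime p" and X: "\<And>n. n \<in> X \<Longrightarrow> int p dvd n \<Longrightarrow> int p ^ 2 dvd n"
  shows "real (residue_count (p ^ 2) X) / real (p ^ 2) \<le> exp (- (1 / 2) * (1 / real p))"
proof -
  have p2: "p \<ge> 2" using p by (rule prime_ge_2_nat)
  let ?B = "(\<lambda>j. int p * j) ` {1..<int p}"
  have B: "?B \<subseteq> {0..<int p ^ 2}"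
    by (auto simp: power2_eq_square)
  have "(\<lambda>x. x mod int (p ^ 2)) ` X \<subseteq> {0..<int p ^ 2} - ?B"
  proof
    fix r assume "r \<in> (\<lambda>x. x mod int (p ^ 2)) ` X"
    then obtain x where x: "x \<in> X" "r = x mod int p ^ 2" by auto
    have "r \<notin> ?B"
    proof
      assume "r \<in> ?B"
      then obtain j where j: "r = int p * j" "1 \<le> j" "j < int p" by auto
      then have "int p dvd x mod int p ^ 2" using x by auto
      then have "int p dvd x" by (simp add: dvd_mod_iff power2_eq_square)
      then have "r = 0" using X x by auto
      then show False using j p2 by simp
    qed
    then show "r \<in> {0..<int p ^ 2} - ?B" using x p2 by simp
  qed
  then have "residue_count (p ^ 2) X \<le> card ({0..<int p ^ 2} - ?B)"
    unfolding residue_count_def by (intro card_mono) auto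
  also have "\<dots> = p ^ 2 - (p - 1)"
  proof -
    have "card ?B = p - 1"
      using p2 by (subst card_image) (auto simp: inj_on_def nat_diff_distrib)
    moreover have "card {0..<int p ^ 2} = p ^ 2" by (simp flip: of_nat_power)
    ultimately show ?thesis using B by (simp add: card_Diff_subset)
  qed
  finally have "real (residue_count (p ^ 2) X) \<le> real p ^ 2 - (real p - 1)"
  proof -
    have "p - 1 \<le> p ^ 2" using p2 by (cases p) (auto simp: power2_eq_square)
    moreover assume "residue_count (p ^ 2) X \<le> p ^ 2 - (p - 1)"
    ultimately have "residue_count (p ^ 2) X + (p - 1) \<le> p ^ 2" by linarith
    then have "real (residue_count (p ^ 2) X + (p - 1)) \<le> real (p ^ 2)" by (rule of_nat_mono)
    then show ?thesis using p2 by simp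
  qed
  then have "real (residue_count (p ^ 2) X) / real (p ^ 2) \<le> 1 + (- (1 / 2) * (1 / real p))"
    using p2 by (simp add: field_simps power2_eq_square)
  also have "\<dots> \<le> exp (- (1 / 2) * (1 / real p))" by (rule exp_ge_add_one_self)
  finally show ?thesis .
qed

text \<open>Multiplying the bounds for the squares of finitely many primes gives \<mu> X \<le> exp
  (- S / 2), where S is the sum of their reciprocals. If \<mu> X were positive, every such S would
  be at most - 2 ln (\<mu> X).\<close>

lemma small_if_not_summable:
  assumes H: "H = UNIV \<or> H = {0..}" and X: "X \<subseteq> H"
    and ns: "\<not> (\<lambda>p. 1 / real p) summable_on
               {p. prime p \<and> (\<forall>n\<in>X. int p dvd n \<longrightarrow> int p ^ 2 dvd n)}" (is "\<not> _ summable_on ?P")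
  shows "small H X"
  unfolding small_def
proof (intro conjI allI impI X)
  fix \<mu> assume \<mu>: "upper_quasi_density H \<mu>"
  show "\<mu> X = 0"
  proof (rule ccontr)
    assume "\<mu> X \<noteq> 0"
    then have pos: "\<mu> X > 0" using upper_quasi_density_nonneg[OF \<mu> X] by simp
    have "sum (\<lambda>p. 1 / real p) P \<le> - 2 * ln (\<mu> X)" if P: "P \<subseteq> ?P" "finite P" for P
    proof -
      have p0: "p > 0" if "p \<in> P" for p using that P by (auto simp: prime_gt_0_nat)
      have "\<mu> X \<le> real (residue_count (\<Prod>p\<in>P. p ^ 2) X) / real (\<Prod>p\<in>P. p ^ 2)"
        using p0 by (intro upper_quasi_density_le_residue_count[OF \<mu> H X] prod_pos) auto
      also have "\<dots> \<le> real (\<Prod>p\<in>P. residue_count (p ^ 2) X) / real (\<Prod>p\<in>P. p ^ 2)"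
      proof (intro divide_right_mono of_nat_mono residue_count_prod_le)
        show "coprime (p ^ 2) (q ^ 2)" if "p \<in> P" "q \<in> P" "p \<noteq> q" for p q
          using that P by (auto intro!: primes_coprime)
      qed (use P p0 in \<open>auto intro!: prod_nonneg\<close>)
      also have "\<dots> = (\<Prod>p\<in>P. real (residue_count (p ^ 2) X) / real (p ^ 2))"
        by (simp add: prod_dividef)
      also have "\<dots> \<le> (\<Prod>p\<in>P. exp (- (1 / 2) * (1 / real p)))"
        using P by (intro prod_mono) (use residue_count_prime_square_le in auto)
      also have "\<dots> = exp (- (1 / 2) * (\<Sum>p\<in>P. 1 / real p))"
        unfolding sum_distrib_left using P by (subst exp_sum) auto
      finally have "ln (\<mu> X) \<le> ln (exp (- (1 / 2) * (\<Sum>p\<in>P. 1 / real p)))"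
        using pos by (subst ln_le_cancel_iff) auto
      then have "ln (\<mu> X) \<le> - (1 / 2) * (\<Sum>p\<in>P. 1 / real p)" by (simp only: ln_exp)
      then show ?thesis by simp
    qed
    then have "(\<lambda>p. 1 / real p) summable_on ?P"
      by (intro nonneg_bdd_above_summable_on bdd_aboveI[of _ "- 2 * ln (\<mu> X)"]) auto
    with ns show False ..
  qed
qed

subsection \<open>Squarefree numbers over a set of primes\<close>

text \<open>Only prime divisors are tested, so \<open>- P\<close> can serve as the complementary set
  of primes although it may contain composite numbers. The number 1 always belongs; 0 never does,
  not being squarefree.\<close>

definition squarefree_over :: "nat set \<Rightarrow> nat set" where
  "squarefree_over P = {n. squarefree n \<and> (\<forall>p. prime p \<longrightarrow> p dvd n \<longrightarrow> p \<in> P)}"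

lemma squarefree_over_pos:
  assumes "n \<in> squarefree_over P"
  shows "n > 0"
proof (rule ccontr)
  assume "\<not> n > 0"
  then show False using assms by (simp add: squarefree_over_def)
qed

lemma squarefree_over_dvd:
  assumes "n \<in> squarefree_over P" and "d dvd n"
  shows "d \<in> squarefree_over P"
  using assms squarefree_mono[of d n] dvd_trans[of _ d n] by (auto simp: squarefree_over_def)

lemma squarefree_over_mult:
  assumes "m \<in> squarefree_over P" and "n \<in> squarefree_over P" and "coprime m n"
  shows "m * n \<in> squarefree_over P"
  using assms by (auto simp: squarefree_over_def prime_dvd_mult_iff intro!: squarefree_mult_coprime)

lemma prime_in_squarefree_over:
  assumes "prime p" and "p \<in> P"
  shows "p \<in> squarefree_over P"
  using assms by (auto simp: squarefree_over_def squarefree_prime dest: primes_dvd_imp_eq)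

lemma squarefree_multiplicity:
  fixes n p :: nat
  assumes "squarefree n" and "prime p"
  shows "multiplicity p n = (if p dvd n then 1 else 0)"
proof -
  have "n \<noteq> 0" using assms(1) by (metis not_squarefree_0)
  moreover have "multiplicity p n \<le> 1"
    using assms \<open>n \<noteq> 0\<close> squarefree_factorial_semiring''[of n] by simp
  moreover have "multiplicity p n > 0 \<longleftrightarrow> p dvd n"
    using \<open>n \<noteq> 0\<close> assms(2) by (auto simp: prime_multiplicity_gt_zero_iff)
  ultimately show ?thesis by auto
qed

lemma squarefree_eqI:
  fixes m n :: nat
  assumes "squarefree m" and "squarefree n" and "\<And>p. prime p \<Longrightarrow> p dvd m \<longleftrightarrow> p dvd n"
  shows "m = n"
proof (rule multiplicity_eq_nat)
  show "m > 0" "n > 0" using assms(1,2) by (metis not_squarefree_0 not_gr_zero)+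
  show "multiplicity p m = multiplicity p n" if "prime p" for p
    using that assms by (simp add: squarefree_multiplicity)
qed

lemma sum_le_sum_inj:
  fixes f :: "'a \<Rightarrow> real" and g :: "'b \<Rightarrow> real"
  assumes "inj_on h A" and "h ` A \<subseteq> B" and "finite B"
    and "\<And>b. b \<in> B \<Longrightarrow> g b \<ge> 0" and "\<And>a. a \<in> A \<Longrightarrow> f a \<le> g (h a)"
  shows "sum f A \<le> sum g B"
proof -
  have "sum f A \<le> (\<Sum>a\<in>A. g (h a))" using assms(5) by (rule sum_mono)
  also have "\<dots> = sum g (h ` A)" using assms(1) by (simp add: sum.reindex)
  also have "\<dots> \<le> sum g B" using assms(2-4) by (intro sum_mono2) auto
  finally show ?thesis .
qed

text \<open>A finite Euler product: expanding the product of 1 + 1/p over the primes p < N yields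
  every 1/n on the left, since n is determined by its set of prime factors. Then 1 + t \<le> exp
  t.\<close>

lemma sum_squarefree_over_le:
  "(\<Sum>n\<in>{n \<in> squarefree_over P. n < N}. 1 / real n)
     \<le> exp (\<Sum>p\<in>{p \<in> P. prime p \<and> p < N}. 1 / real p)"
proof -
  let ?B = "{p \<in> P. prime p \<and> p < N}"
  let ?A = "{n \<in> squarefree_over P. n < N}"
  \<comment> \<open>The trivial product over \<open>?B - X\<close> gives the right side the shape
    that \<open>prod_add\<close> produces.\<close>
  have "(\<Sum>n\<in>?A. 1 / real n) \<le> (\<Sum>X\<in>Pow ?B. (\<Prod>p\<in>X. 1 / real p) * (\<Prod>p\<in>?B - X. 1))"
  proof (rule sum_le_sum_inj[where h = prime_factors])
    show "inj_on prime_factors ?A"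
    proof (rule inj_onI)
      fix m n assume mn: "m \<in> ?A" "n \<in> ?A" and eq: "prime_factors m = prime_factors n"
      then have pos: "m > 0" "n > 0" using squarefree_over_pos by auto
      show "m = n"
      proof (rule squarefree_eqI)
        fix p :: nat assume "prime p"
        then show "p dvd m \<longleftrightarrow> p dvd n"
          using eq pos by (metis in_prime_factors_iff not_gr_zero)
      qed (use mn in \<open>auto simp: squarefree_over_def\<close>)
    qed
    show "prime_factors ` ?A \<subseteq> Pow ?B"
    proof safe
      fix n p assume n: "n \<in> squarefree_over P" "n < N" and "p \<in> prime_factors n"
      then have p: "prime p" "p dvd n" by auto
      then show "prime p" "p \<in> P" using n by (auto simp: squarefree_over_def)
      show "p < N" using p n squarefree_over_pos[OF n(1)] dvd_imp_le[of p n] by linarith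
    qed
    show "1 / real n \<le> (\<Prod>p\<in>prime_factors n. 1 / real p) * (\<Prod>p\<in>?B - prime_factors n. 1)"
      if "n \<in> ?A" for n
    proof -
      have "n = (\<Prod>p\<in>prime_factors n. p ^ multiplicity p n)"
        using that squarefree_over_pos by (intro prime_factorization_nat) auto
      also have "\<dots> = (\<Prod>p\<in>prime_factors n. p)"
        using that by (intro prod.cong refl) 
          (auto simp: squarefree_multiplicity squarefree_over_def in_prime_factors_iff)
      finally have "real n = real (\<Prod>p\<in>prime_factors n. p)"
        by (rule arg_cong)
      then have "1 / real n = (\<Prod>p\<in>prime_factors n. 1 / real p)"
        by (simp only: of_nat_prod prod_dividef prod.neutral_const)
      then show ?thesis by simp
    qed
  qed (auto intro!: mult_nonneg_nonneg prod_nonneg)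
  also have "\<dots> = (\<Prod>p\<in>?B. 1 / real p + 1)"
    by (subst prod_add) auto
  also have "\<dots> \<le> (\<Prod>p\<in>?B. exp (1 / real p))"
    using exp_ge_add_one_self by (intro prod_mono) (auto simp: add.commute)
  also have "\<dots> = exp (\<Sum>p\<in>?B. 1 / real p)"
    by (subst exp_sum) auto
  finally show ?thesis .
qed

text \<open>Induction on the prime factors: a further prime p joins s or t if it is new there;
  otherwise it is removed and its two copies move into q^2.\<close>

lemma squarefree_over_decomposition:
  fixes n :: nat
  assumes "n > 0"
  shows "\<exists>s t q. s \<in> squarefree_over P \<and> t \<in> squarefree_over (- P) \<and> n = s * t * q ^ 2"
  using assms
proof (induction n rule: prime_divisors_induct)
  case (unit n)
  then show ?case by (intro exI[of _ 1]) (auto simp: squarefree_over_def)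
next
  case (factor p n)
  then have "n > 0" by simp
  then obtain s t q where st: "s \<in> squarefree_over P" "t \<in> squarefree_over (- P)" "n = s * t * q ^ 2"
    using factor.IH by blast
  have mult: "\<exists>r' q'. r' \<in> squarefree_over Q \<and> p * r = r' * q' ^ 2"
    if "p \<in> Q" "r \<in> squarefree_over Q" for r Q
  proof (cases "p dvd r")
    case True
    then obtain r' where "r = p * r'" ..
    then show ?thesis using squarefree_over_dvd[OF that(2), of r']
      by (intro exI[of _ r'] exI[of _ p]) (auto simp: power2_eq_square)
  next
    case False
    then have "coprime p r" using factor.hyps by (simp add: prime_imp_coprime)
    then show ?thesis
      using squarefree_over_mult[OF prime_in_squarefree_over[OF factor.hyps that(1)] that(2)]
      by (intro exI[of _ "p * r"] exI[of _ 1]) auto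
  qed
  show ?case
  proof (cases "p \<in> P")
    case True
    then obtain s' q' where "s' \<in> squarefree_over P" "p * s = s' * q' ^ 2"
      using mult st by blast
    moreover have "p * n = (p * s) * t * q ^ 2" by (simp add: st)
    ultimately show ?thesis using st
      by (intro exI[of _ s'] exI[of _ t] exI[of _ "q' * q"]) (simp add: power_mult_distrib)
  next
    case False
    then obtain t' q' where "t' \<in> squarefree_over (- P)" "p * t = t' * q' ^ 2"
      using mult[of "- P" t] st by auto
    moreover have "p * n = s * (p * t) * q ^ 2" by (simp add: st)
    ultimately show ?thesis using st
      by (intro exI[of _ s] exI[of _ t'] exI[of _ "q' * q"]) (simp add: power_mult_distrib)
  qed
qed simp

section \<open>Reciprocal sums of squarefree numbers\<close>

lemma sum_inverse_squares_le: "(\<Sum>q\<in>{1..<n}. 1 / real q ^ 2) \<le> 2"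
proof -
  \<comment> \<open>The stronger bound with the subtracted term carries the induction, through 1/q^2
    \<le> 1/(q - 1) - 1/q.\<close>
  have telescope: "(\<Sum>q\<in>{1..<Suc (Suc n)}. 1 / real q ^ 2) \<le> 2 - 1 / real (Suc n)" for n
  proof (induction n)
    case (Suc n)
    have "1 / real (Suc (Suc n)) ^ 2 \<le> 1 / (real (Suc n) * real (Suc (Suc n)))"
      unfolding power2_eq_square by (intro divide_left_mono mult_right_mono) auto
    also have "\<dots> = 1 / real (Suc n) - 1 / real (Suc (Suc n))"
      by (simp add: field_simps)
    finally show ?case using Suc by simp
  qed simp
  show ?thesis
  proof (cases "n \<le> 1")
    case False
    then obtain m where "n = Suc (Suc m)" by (metis One_nat_def not_less_eq_eq not0_implies_Suc le0)
    then show ?thesis using telescope[of m] by (smt (verit) divide_nonneg_nonneg of_nat_0_le_iff)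
  qed auto
qed

text \<open>Each dyadic block contributes at least 1/2.\<close>

lemma sum_harmonic_ge: "real J / 2 \<le> (\<Sum>n\<in>{1..<2 ^ J}. 1 / real n)"
proof (induction J)
  case (Suc J)
  have "{1..<2 ^ Suc J} = {1..<2 ^ J} \<union> {2 ^ J..<2 ^ Suc J :: nat}"
    by (simp add: ivl_disj_un_two(3))
  then have "(\<Sum>n\<in>{1..<2 ^ Suc J}. 1 / real n)
      = (\<Sum>n\<in>{1..<2 ^ J}. 1 / real n) + (\<Sum>n\<in>{2 ^ J..<2 ^ Suc J}. 1 / real n)"
    by (simp only:) (rule sum.union_disjoint; auto)
  moreover have "(\<Sum>n\<in>{2 ^ J..<2 ^ Suc J :: nat}. 1 / 2 ^ Suc J) \<le> (\<Sum>n\<in>{2 ^ J..<2 ^ Suc J}. 1 / real n)"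
  proof (rule sum_mono)
    fix n :: nat assume n: "n \<in> {2 ^ J..<2 ^ Suc J}"
    then have "real n \<le> real (2 ^ Suc J)" by (intro of_nat_mono) auto
    moreover have "n > 0" using n by (auto intro!: Nat.gr0I)
    ultimately show "1 / 2 ^ Suc J \<le> 1 / real n" by (intro divide_left_mono) auto
  qed
  moreover have "(\<Sum>n\<in>{2 ^ J..<2 ^ Suc J :: nat}. 1 / 2 ^ Suc J) = (1 / 2 :: real)"
    by (simp add: field_simps)
  ultimately show ?case using Suc by (simp add: field_simps)
qed simp

text \<open>Writing n = s t q^2 bounds the harmonic sum by a product of three sums: the one over q
  is at most 2, and the one over t is bounded by the Euler product for the primes outside
  \<open>P\<close>.\<close>

lemma harmonic_le_squarefree_over:
  "real J / 2 \<le> 2 * exp (\<Sum>p\<in>{p \<in> - P. prime p \<and> p < 2 ^ J}. 1 / real p)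
     * (\<Sum>s\<in>{s \<in> squarefree_over P. s < 2 ^ J}. 1 / real s)"
proof -
  let ?N = "2 ^ J :: nat"
  let ?S = "\<lambda>P. {s \<in> squarefree_over P. s < ?N}"
  define Q where "Q n w \<longleftrightarrow> (case w of (s, t, q) \<Rightarrow>
    s \<in> squarefree_over P \<and> t \<in> squarefree_over (- P) \<and> n = s * t * q ^ 2)" for n w
  have "\<forall>n\<in>{1..<?N}. \<exists>w. Q n w"
    using squarefree_over_decomposition[of _ P] by (fastforce simp: Q_def)
  then obtain f where f: "\<And>n. n \<in> {1..<?N} \<Longrightarrow> Q n (f n)"
    by metis
  have "real J / 2 \<le> (\<Sum>n\<in>{1..<?N}. 1 / real n)" by (rule sum_harmonic_ge)
  also have "\<dots> \<le> (\<Sum>(s, t, q)\<in>?S P \<times> ?S (- P) \<times> {1..<?N}. 1 / real s * (1 / real t * (1 / real q ^ 2)))"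
  proof (rule sum_le_sum_inj[where h = f])
    show "inj_on f {1..<?N}"
    proof (rule inj_onI)
      fix m n assume "m \<in> {1..<?N}" "n \<in> {1..<?N}" "f m = f n"
      then show "m = n" using f[of m] f[of n] by (auto simp: Q_def split: prod.splits)
    qed
    show "f ` {1..<?N} \<subseteq> ?S P \<times> ?S (- P) \<times> {1..<?N}"
    proof (rule image_subsetI)
      fix n assume n: "n \<in> {1..<?N}"
      obtain s t q where w: "f n = (s, t, q)" by (cases "f n") auto
      then have Q: "s \<in> squarefree_over P" "t \<in> squarefree_over (- P)" "n = s * t * q ^ 2"
        using f[OF n] by (auto simp: Q_def)
      then have "s dvd n" "t dvd n" "q dvd n" by (auto simp: power2_eq_square)
      then have "s \<le> n" "t \<le> n" "q \<le> n" using n by (auto intro!: dvd_imp_le)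
      moreover have "q > 0" using Q n by (auto intro!: Nat.gr0I)
      moreover have "n < ?N" using n by simp
      ultimately show "f n \<in> ?S P \<times> ?S (- P) \<times> {1..<?N}" using Q(1,2) by (simp add: w)
    qed
    show "1 / real n \<le> (case f n of (s, t, q) \<Rightarrow> 1 / real s * (1 / real t * (1 / real q ^ 2)))"
      if "n \<in> {1..<?N}" for n
      using f[OF that] by (auto simp: Q_def split: prod.splits)
  qed auto
  also have "\<dots> = (\<Sum>s\<in>?S P. 1 / real s) * ((\<Sum>t\<in>?S (- P). 1 / real t) * (\<Sum>q\<in>{1..<?N}. 1 / real q ^ 2))"
    by (simp only: sum_product sum.cartesian_product split_def)
  also have "\<dots> \<le> (\<Sum>s\<in>?S P. 1 / real s) * (exp (\<Sum>p\<in>{p \<in> - P. prime p \<and> p < 2 ^ J}. 1 / real p) * 2)"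
    using sum_squarefree_over_le[of "- P" ?N] sum_inverse_squares_le[of ?N]
    by (intro mult_left_mono mult_mono sum_nonneg) auto
  finally show ?thesis by (simp add: mult_ac)
qed

lemma finite_squarefree_over_pairs:
  "finite {(u, v). u * v \<in> squarefree_over P \<and> u * v < M}"
proof (rule finite_subset)
  show "{(u, v). u * v \<in> squarefree_over P \<and> u * v < M} \<subseteq> {..<M} \<times> {..<M}"
  proof safe
    fix u v assume uv: "u * v \<in> squarefree_over P" "u * v < M"
    then have "u * v > 0" using squarefree_over_pos by blast
    then have "u \<le> u * v" "v \<le> u * v" by auto
    then show "u < M" "v < M" using uv by linarith+
  qed
qed auto

text \<open>The square is a double sum over (s, s'). With g = gcd s s', s = g u and s' = g v, the
  cofactors are coprime, so u v is again squarefree over \<open>P\<close>, and 1/(s s') = 1/g^2 *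
  1/(u v). The sum over g is at most 2.\<close>

lemma sum_squarefree_over_square_le:
  "(\<Sum>s\<in>{s \<in> squarefree_over P. s < N}. 1 / real s) ^ 2
     \<le> 2 * (\<Sum>(u, v)\<in>{(u, v). u * v \<in> squarefree_over P \<and> u * v < N ^ 2}. 1 / real (u * v))"
proof -
  let ?S = "{s \<in> squarefree_over P. s < N}"
  let ?A = "{(u, v). u * v \<in> squarefree_over P \<and> u * v < N ^ 2}"
  let ?f = "\<lambda>(s, s'). (gcd s s', s div gcd s s', s' div gcd s s')"
  have "(\<Sum>s\<in>?S. 1 / real s) ^ 2 = (\<Sum>(s, s')\<in>?S \<times> ?S. 1 / real s * (1 / real s'))"
    by (simp only: power2_eq_square sum_product sum.cartesian_product)
  also have "\<dots> \<le> (\<Sum>(g, w)\<in>{1..<N} \<times> ?A. 1 / real g ^ 2 * (case w of (u, v) \<Rightarrow> 1 / real (u * v)))"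
  proof (rule sum_le_sum_inj[where h = ?f])
    show "inj_on ?f (?S \<times> ?S)"
      by (rule inj_on_inverseI[where g = "\<lambda>(g, u, v). (g * u, g * v)"]) auto
    show "?f ` (?S \<times> ?S) \<subseteq> {1..<N} \<times> ?A"
    proof safe
      fix s s' assume s: "s \<in> squarefree_over P" "s < N" "s' \<in> squarefree_over P" "s' < N"
      then have pos: "s > 0" "s' > 0" using squarefree_over_pos by auto
      define g where "g = gcd s s'"
      have g: "g dvd s" "g dvd s'" "g > 0" using pos by (auto simp: g_def)
      have "coprime (s div g) (s' div g)" using pos by (simp add: g_def div_gcd_coprime)
      moreover have "s div g \<in> squarefree_over P" "s' div g \<in> squarefree_over P"
        using s g by (metis squarefree_over_dvd dvd_div_mult_self dvd_triv_left)+
      ultimately show "s div gcd s s' * (s' div gcd s s') \<in> squarefree_over P"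
        by (auto simp: g_def intro: squarefree_over_mult)
      have "s div g * (s' div g) \<le> s * s'" by (intro mult_le_mono) auto
      also have "\<dots> < N * N" using s by (intro mult_strict_mono) auto
      finally show "s div gcd s s' * (s' div gcd s s') < N\<^sup>2" by (simp add: g_def power2_eq_square)
      have "g \<le> s" using g pos by (intro dvd_imp_le) auto
      then show "gcd s s' \<in> {1..<N}" using g(3) s by (simp flip: g_def)
    qed
    show "(case w of (s, s') \<Rightarrow> 1 / real s * (1 / real s'))
      \<le> (case ?f w of (g, w) \<Rightarrow> 1 / real g ^ 2 * (case w of (u, v) \<Rightarrow> 1 / real (u * v)))"
      if "w \<in> ?S \<times> ?S" for w
    proof -
      obtain s s' where w: "w = (s, s')" by (cases w) auto
      define g where "g = gcd s s'"
      have "g dvd s" "g dvd s'" by (simp_all add: g_def)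
      then obtain u v where uv: "s = g * u" "s' = g * v" by (elim dvdE)
      have "g > 0" using that w squarefree_over_pos by (auto simp: g_def)
      then have "s div g = u" "s' div g = v" using uv by auto
      then show ?thesis by (simp add: w flip: g_def) (simp add: uv power2_eq_square mult_ac)
    qed
    show "finite ({1..<N} \<times> ?A)"
      by (intro finite_cartesian_product finite_squarefree_over_pairs) simp
  qed auto
  also have "\<dots> = (\<Sum>g\<in>{1..<N}. 1 / real g ^ 2) * (\<Sum>(u, v)\<in>?A. 1 / real (u * v))"
    by (simp only: sum_product sum.cartesian_product)
  also have "\<dots> \<le> 2 * (\<Sum>(u, v)\<in>?A. 1 / real (u * v))"
    by (intro mult_right_mono sum_inverse_squares_le sum_nonneg) auto
  finally show ?thesis .
qed

subsection \<open>Primes modulo which a nonsquare is a nonresidue\<close>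

text \<open>A nontrivial zero would make D the square of the integer x / y.\<close>

lemma pell_form_nonzero:
  fixes D x y :: int
  assumes "\<not> is_square D" and "x \<noteq> 0 \<or> y \<noteq> 0"
  shows "x ^ 2 - D * y ^ 2 \<noteq> 0"
proof
  assume *: "x ^ 2 - D * y ^ 2 = 0"
  then have "y ^ 2 dvd x ^ 2" by simp
  then have "y dvd x" by simp
  then obtain z where z: "x = y * z" ..
  have "y \<noteq> 0" using * assms(2) by auto
  moreover have "y ^ 2 * (z ^ 2 - D) = 0" using * by (simp add: z algebra_simps power2_eq_square)
  ultimately have "D = z ^ 2" by simp
  then show False using assms(1) by simp
qed

text \<open>Thue's pigeonhole argument, run simultaneously with the root R modulo u and - R modulo v.\<close>
lemma thue_split:
  fixes D R :: int and u v :: nat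
  assumes D: "\<not> is_square D" and pos: "u * v > 0" and root: "int (u * v) dvd R ^ 2 - D"
  shows "\<exists>x y k. x ^ 2 - D * y ^ 2 = k * int (u * v) \<and> int u dvd x - R * y \<and> int v dvd x + R * y
           \<and> x ^ 2 \<le> int (u * v) \<and> y ^ 2 \<le> int (u * v) \<and> k \<noteq> 0 \<and> \<bar>k\<bar> \<le> 1 + \<bar>D\<bar>"
proof -
  \<comment> \<open>The integer part of the square root: (s + 1)^2 exceeds u v, so the box has more
    points than there are residue pairs, while differences of coordinates stay at most s.\<close>
  define s where "s = nat \<lfloor>sqrt (real (u * v))\<rfloor>"
  have s1: "s ^ 2 \<le> u * v"
  proof -
    have "real s \<le> sqrt (real (u * v))" by (simp add: s_def)
    then have "real s ^ 2 \<le> real (u * v)" by (metis of_nat_0_le_iff real_sqrt_pow2 power_mono)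
    then show ?thesis by (metis of_nat_le_iff of_nat_power)
  qed
  have s2: "u * v < Suc s ^ 2"
  proof -
    have "sqrt (real (u * v)) < real (Suc s)" unfolding s_def by linarith
    then have "real (u * v) < real (Suc s) ^ 2"
      by (metis real_sqrt_less_iff real_sqrt_abs abs_of_nat)
    then show ?thesis by (metis of_nat_less_iff of_nat_power)
  qed
  let ?A = "{0..int s} \<times> {0..int s}"
  let ?f = "\<lambda>(x, y). ((x - R * y) mod int u, (x + R * y) mod int v)"
  have "?f ` ?A \<subseteq> {0..<int u} \<times> {0..<int v}" using pos by auto
  then have "card (?f ` ?A) \<le> card ({0..<int u} \<times> {0..<int v})" by (intro card_mono) auto
  also have "\<dots> < card ?A" using s2 by (simp add: card_cartesian_product power2_eq_square nat_add_distrib)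
  finally have "\<not> inj_on ?f ?A" by (rule pigeonhole)
  then obtain w w' where w: "w \<in> ?A" "w' \<in> ?A" "?f w = ?f w'" "w \<noteq> w'" unfolding inj_on_def by blast
  obtain x1 y1 x2 y2 where ww: "w = (x1, y1)" "w' = (x2, y2)" by (cases w, cases w') auto
  define x y where "x = x1 - x2" and "y = y1 - y2"
  have "int u dvd (x1 - R * y1) - (x2 - R * y2)" "int v dvd (x1 + R * y1) - (x2 + R * y2)"
    using w(3) by (simp_all add: ww mod_eq_dvd_iff)
  then have uv: "int u dvd x - R * y" "int v dvd x + R * y"
    by (simp_all add: x_def y_def algebra_simps)
  \<comment> \<open>The product is x^2 - R^2 y^2, and R^2 may be replaced by D modulo u v.\<close>
  have "int u * int v dvd (x - R * y) * (x + R * y)" using uv by (rule mult_dvd_mono)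
  then have "int (u * v) dvd (x - R * y) * (x + R * y) + (R ^ 2 - D) * y ^ 2"
    using root by (intro dvd_add) auto
  also have "(x - R * y) * (x + R * y) + (R ^ 2 - D) * y ^ 2 = x ^ 2 - D * y ^ 2"
    by (simp add: algebra_simps power2_eq_square)
  finally obtain k where k: "x ^ 2 - D * y ^ 2 = int (u * v) * k" ..
  have sq: "x ^ 2 \<le> int (u * v)" "y ^ 2 \<le> int (u * v)"
  proof -
    have "\<bar>x\<bar> \<le> int s" "\<bar>y\<bar> \<le> int s" using w by (auto simp: ww x_def y_def)
    then have "x ^ 2 \<le> int s ^ 2" "y ^ 2 \<le> int s ^ 2" by (simp_all add: abs_le_square_iff[symmetric])
    moreover have "int s ^ 2 \<le> int (u * v)" using s1 by (metis of_nat_le_iff of_nat_power)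
    ultimately show "x ^ 2 \<le> int (u * v)" "y ^ 2 \<le> int (u * v)" by linarith+
  qed
  have nz: "x ^ 2 - D * y ^ 2 \<noteq> 0"
    using w by (intro pell_form_nonzero[OF D]) (auto simp: ww x_def y_def)
  have "int (u * v) * \<bar>k\<bar> = \<bar>x ^ 2 - D * y ^ 2\<bar>" by (simp add: k abs_mult)
  also have "\<dots> \<le> x ^ 2 + \<bar>D\<bar> * y ^ 2"
    using abs_triangle_ineq4[of "x ^ 2" "D * y ^ 2"] by (simp add: abs_mult)
  also have "\<dots> \<le> int (u * v) + \<bar>D\<bar> * int (u * v)"
    using sq by (intro add_mono mult_left_mono) auto
  also have "\<dots> = int (u * v) * (1 + \<bar>D\<bar>)" by (simp add: algebra_simps)
  finally have "\<bar>k\<bar> \<le> 1 + \<bar>D\<bar>" using pos by (simp add: mult_le_cancel_left)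
  then show ?thesis using k nz uv sq by (intro exI[of _ x] exI[of _ y] exI[of _ k]) (auto simp: mult.commute)
qed

text \<open>For nonsquare D these are the odd primes not dividing D that split in the quadratic
  field of D. Leaving out 2 and the divisors of D keeps the roots R and - R distinct modulo
  p.\<close>

definition split_primes :: "int \<Rightarrow> nat set" where
  "split_primes D = {p. prime p \<and> odd p \<and> \<not> int p dvd D \<and> QuadRes (int p) D}"

section \<open>Square roots of D modulo squarefree products of split primes\<close>

lemma QuadRes_iff_dvd: "QuadRes m a \<longleftrightarrow> (\<exists>y. m dvd y ^ 2 - a)"
  by (simp add: QuadRes_def cong_iff_dvd_diff)

lemma QuadRes_mult:
  assumes "QuadRes m a" and "QuadRes n a" and "coprime m n"
  shows "QuadRes (m * n) a"
proof -
  obtain y z where yz: "m dvd y ^ 2 - a" "n dvd z ^ 2 - a" using assms by (auto simp: QuadRes_iff_dvd)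
  obtain x where x: "[x = y] (mod m)" "[x = z] (mod n)"
    using binary_chinese_remainder_int[OF assms(3)] by blast
  have "[x ^ 2 = y ^ 2] (mod m)" "[x ^ 2 = z ^ 2] (mod n)" using x by (auto intro: cong_pow)
  then have "[x ^ 2 = a] (mod m)" "[x ^ 2 = a] (mod n)"
    using yz by (auto simp: cong_iff_dvd_diff[symmetric] intro: cong_trans)
  then show ?thesis using assms(3) by (auto simp: QuadRes_def intro: coprime_cong_mult)
qed

text \<open>Roots modulo the prime factors are glued one at a time; squarefreeness makes each new
  prime coprime to the rest.\<close>

lemma QuadRes_squarefree_over_split_primes:
  assumes "n \<in> squarefree_over (split_primes D)"
  shows "QuadRes (int n) D"
  using assms
proof (induction n rule: prime_divisors_induct)
  case zero
  then show ?case using squarefree_over_pos by blast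
next
  case (unit n)
  then show ?case by (simp add: QuadRes_iff_dvd)
next
  case (factor p n)
  have "p \<in> split_primes D" using factor by (auto simp: squarefree_over_def)
  moreover have "n \<in> squarefree_over (split_primes D)"
    using factor.prems by (rule squarefree_over_dvd) simp
  moreover have "\<not> p dvd n"
  proof
    assume "p dvd n"
    then have "p ^ 2 dvd p * n" by (simp add: power2_eq_square)
    then have "is_unit p" using factor.prems squarefreeD[of "p * n" p] by (auto simp: squarefree_over_def)
    then show False using factor.hyps not_prime_unit by blast
  qed
  then have "coprime (int p) (int n)" using factor.hyps by (simp add: prime_imp_coprime)
  ultimately show ?case using factor.IH by (auto simp: split_primes_def intro!: QuadRes_mult)
qed

text \<open>Given x, y, k, every prime p dividing m = u v but not k divides exactly one of x - R y and
  x + R y, which tells whether it belongs to u or to v; gcd u k records the remaining primes.\<close>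
lemma split_pair_determined:
  fixes x y k R D :: int and u v u' v' :: nat
  assumes m: "u * v = u' * v'" and mem: "u * v \<in> squarefree_over (split_primes D)"
    and R: "int (u * v) dvd R ^ 2 - D" and k: "x ^ 2 - D * y ^ 2 = k * int (u * v)"
    and u: "int u dvd x - R * y" and v': "int v' dvd x + R * y"
    and g: "gcd (int u) k = gcd (int u') k" and p: "prime p" "p dvd u"
  shows "p dvd u'"
proof (cases "int p dvd k")
  case True
  then have "int p dvd gcd (int u) k" using p by simp
  then have "int p dvd int u'" unfolding g by simp
  then show ?thesis by simp
next
  case False
  show ?thesis
  proof (rule ccontr)
    assume "\<not> p dvd u'"
    have pm: "p dvd u * v" using p by simp
    then have "p dvd v'" using \<open>\<not> p dvd u'\<close> p m by (simp add: prime_dvd_mult_iff)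
    have ip: "prime (int p)" using p by simp
    have split: "p \<in> split_primes D" using mem pm p by (auto simp: squarefree_over_def)
    \<comment> \<open>Now p divides both factors. Being odd and not dividing R, it divides x and y,
      so p^2 divides k u v; this contradicts p not dividing k and u v being squarefree.\<close>
    have dvd: "int p dvd x - R * y" "int p dvd x + R * y"
      using p u v' \<open>p dvd v'\<close> by (meson dvd_trans int_dvd_int_iff)+
    have d: "int p dvd 2 * x" "int p dvd 2 * (R * y)"
      using dvd_add[OF dvd] dvd_diff[OF dvd(2,1)] by (simp_all add: algebra_simps)
    have "\<not> int p dvd 2"
    proof
      assume "int p dvd 2"
      then have "p dvd 2" by presburger
      then show False using p split primes_dvd_imp_eq[of p 2] by (auto simp: split_primes_def)
    qed
    then have d': "int p dvd x" "int p dvd R * y" using d ip by (auto simp: prime_dvd_mult_iff)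
    have "\<not> int p dvd R"
    proof
      assume "int p dvd R"
      then have "int p dvd R ^ 2" by (simp add: power2_eq_square)
      moreover have "int p dvd R ^ 2 - D" using R pm by (meson dvd_trans int_dvd_int_iff)
      ultimately have "int p dvd D" by (metis dvd_diff_right_iff)
      then show False using split by (simp add: split_primes_def)
    qed
    then have "int p dvd y" using d' ip by (auto simp: prime_dvd_mult_iff)
    then have "int p ^ 2 dvd x ^ 2 - D * y ^ 2" using d' by (intro dvd_diff dvd_mult) auto
    then have "int p ^ 2 dvd k * int (u * v)" by (simp only: k)
    moreover have "coprime (int p ^ 2) k" using ip False by (simp add: prime_imp_coprime)
    ultimately have "int p ^ 2 dvd int (u * v)" by (simp add: coprime_dvd_mult_right_iff)
    then have "p ^ 2 dvd u * v" by (metis of_nat_power int_dvd_int_iff)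
    then have "is_unit p" using mem squarefreeD[of "u * v" p] by (simp add: squarefree_over_def)
    then show False using p by auto
  qed
qed

text \<open>A pair is encoded by its Thue data (x, y, k) together with gcd u k. The data determine u
  v, hence the root R, and then \<open>split_pair_determined\<close> recovers the primes of
  u.\<close>

lemma card_split_pairs_le:
  assumes D: "\<not> is_square D"
  shows "card {(u, v). u * v \<in> squarefree_over (split_primes D) \<and> u * v < N ^ 2}
           \<le> 9 * nat (3 + 2 * \<bar>D\<bar>) * nat (2 + \<bar>D\<bar>) * N ^ 2"
proof (cases "N = 0")
  case False
  let ?A = "{(u, v). u * v \<in> squarefree_over (split_primes D) \<and> u * v < N ^ 2}"
  let ?K = "1 + \<bar>D\<bar>"
  have "\<forall>n. \<exists>R. n \<in> squarefree_over (split_primes D) \<longrightarrow> int n dvd R ^ 2 - D"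
    using QuadRes_squarefree_over_split_primes by (auto simp: QuadRes_iff_dvd)
  \<comment> \<open>The root depends on the product alone, so two pairs with the same product are
    compared with the same root.\<close>
  then obtain R where R: "\<And>n. n \<in> squarefree_over (split_primes D) \<Longrightarrow> int n dvd R n ^ 2 - D"
    by metis
  define Q where "Q w t \<longleftrightarrow> (case (w, t) of ((u, v), (x, y, k)) \<Rightarrow>
      x ^ 2 - D * y ^ 2 = k * int (u * v) \<and> int u dvd x - R (u * v) * y \<and> int v dvd x + R (u * v) * y
      \<and> x ^ 2 \<le> int (u * v) \<and> y ^ 2 \<le> int (u * v) \<and> k \<noteq> 0 \<and> \<bar>k\<bar> \<le> ?K)" for w t
  have "\<exists>t. Q w t" if "w \<in> ?A" for w
  proof -
    obtain u v where w: "w = (u, v)" by (cases w) auto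
    then have mem: "u * v \<in> squarefree_over (split_primes D)" using that by simp
    from thue_split[OF D squarefree_over_pos[OF mem] R[OF mem]]
    obtain x y k where "Q w (x, y, k)" unfolding Q_def w prod.case by blast
    then show ?thesis ..
  qed
  then have "\<forall>w\<in>?A. \<exists>t. Q w t" by (rule ballI)
  then obtain F where "\<forall>w\<in>?A. Q w (F w)" unfolding bchoice_iff by (rule exE)
  then have F: "Q w (F w)" if "w \<in> ?A" for w using that by (rule bspec)
  let ?f = "\<lambda>w. (F w, gcd (int (fst w)) (snd (snd (F w))))"
  let ?B = "({- int N..int N} \<times> {- int N..int N} \<times> {- ?K..?K}) \<times> {0..?K}"
  have "inj_on ?f ?A"
  proof (rule inj_onI)
    fix w w' assume w: "w \<in> ?A" "w' \<in> ?A" and eq: "?f w = ?f w'"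
    obtain u v u' v' where ww: "w = (u, v)" "w' = (u', v')" by (cases w, cases w') auto
    obtain x y k where t: "F w = (x, y, k)" by (cases "F w") auto
    then have t': "F w' = (x, y, k)" using eq by simp
    have "gcd (int (fst w)) (snd (snd (F w))) = gcd (int (fst w')) (snd (snd (F w')))"
      using eq[unfolded prod.inject] by (rule conjunct2)
    then have g: "gcd (int u) k = gcd (int u') k" unfolding t t' by (simp add: ww)
    have "Q (u, v) (x, y, k)" "Q (u', v') (x, y, k)"
      using F[OF w(1)] F[OF w(2)] unfolding t t' unfolding ww .
    note q = this[unfolded Q_def prod.case]
    have mem: "u * v \<in> squarefree_over (split_primes D)" using w ww by simp
    \<comment> \<open>Both sides equal x^2 - D y^2.\<close>
    have "k * int (u * v) = k * int (u' * v')" "k \<noteq> 0"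
      using conjunct1[OF q(1)] conjunct1[OF q(2)] q(1) by simp_all
    then have m: "u * v = u' * v'" by (metis mult_left_cancel of_nat_eq_iff)
    have "u = u'"
    proof (rule squarefree_eqI)
      have "u \<in> squarefree_over (split_primes D)" using mem by (rule squarefree_over_dvd) simp
      moreover have "u' \<in> squarefree_over (split_primes D)"
        using mem unfolding m by (rule squarefree_over_dvd) simp
      ultimately show "squarefree u" "squarefree u'" by (simp_all add: squarefree_over_def)
      fix p :: nat assume "prime p"
      show "p dvd u \<longleftrightarrow> p dvd u'"
      proof
        show "p dvd u'" if "p dvd u"
          by (rule split_pair_determined[where x = x and y = y, OF m mem R[OF mem] _ _ _ g \<open>prime p\<close> that])
            (use q in \<open>simp_all add: m\<close>)
        show "p dvd u" if "p dvd u'"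
          by (rule split_pair_determined[where x = x and y = y, OF m[symmetric] mem[unfolded m] R[OF mem[unfolded m]] _ _ _
                g[symmetric] \<open>prime p\<close> that])
            (use q in \<open>simp_all add: m\<close>)
      qed
    qed
    moreover have "u > 0" using squarefree_over_pos[OF mem] by simp
    ultimately show "w = w'" using m by (simp add: ww)
  qed
  moreover have "?f ` ?A \<subseteq> ?B"
  proof (rule image_subsetI)
    fix w assume w: "w \<in> ?A"
    obtain u v where ww: "w = (u, v)" by (cases w) auto
    obtain x y k where t: "F w = (x, y, k)" by (cases "F w") auto
    have "Q (u, v) (x, y, k)" using F[OF w] unfolding t unfolding ww .
    note q = this[unfolded Q_def prod.case]
    have "int (u * v) < int N ^ 2" using w by (simp add: ww flip: of_nat_power of_nat_mult)
    then have "x ^ 2 \<le> int N ^ 2" "y ^ 2 \<le> int N ^ 2" using q by linarith+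
    then have "\<bar>x\<bar> \<le> int N" "\<bar>y\<bar> \<le> int N" by (simp_all add: abs_le_square_iff[symmetric])
    moreover have "gcd (int u) k \<le> \<bar>k\<bar>" using q by (intro zdvd_imp_le) auto
    moreover have "?f w = ((x, y, k), gcd (int u) k)" unfolding t by (simp add: ww)
    ultimately show "?f w \<in> ?B" using q by auto
  qed
  ultimately have "card ?A \<le> card ?B" by (intro card_inj_on_le) auto
  also have "card ?B = (2 * N + 1) * ((2 * N + 1) * nat (3 + 2 * \<bar>D\<bar>)) * nat (2 + \<bar>D\<bar>)"
  proof -
    have "card {- int N..int N} = 2 * N + 1" by simp
    moreover have "card {- ?K..?K} = nat (3 + 2 * \<bar>D\<bar>)" "card {0..?K} = nat (2 + \<bar>D\<bar>)"
      by (simp_all add: algebra_simps)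
    ultimately show ?thesis by (simp only: card_cartesian_product)
  qed
  \<comment> \<open>Here 2N + 1 \<le> 3N uses N > 0, whence the separate case N = 0.\<close>
  also have "\<dots> \<le> (3 * N) * ((3 * N) * nat (3 + 2 * \<bar>D\<bar>)) * nat (2 + \<bar>D\<bar>)"
    using False by (intro mult_le_mono order_refl) simp_all
  finally show ?thesis by (simp add: power2_eq_square mult_ac)
qed simp

section \<open>Dyadic summation and divergence\<close>

lemma sum_split_pairs_le:
  assumes D: "\<not> is_square D"
  shows "\<exists>C. \<forall>J. (\<Sum>(u, v)\<in>{(u, v). u * v \<in> squarefree_over (split_primes D) \<and> u * v < (2 ^ J) ^ 2}.
           1 / real (u * v)) \<le> C * real J"
proof -
  define C where "C = 9 * nat (3 + 2 * \<bar>D\<bar>) * nat (2 + \<bar>D\<bar>)"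
  let ?A = "\<lambda>J. {(u, v). u * v \<in> squarefree_over (split_primes D) \<and> u * v < (2 ^ J) ^ 2}"
  let ?s = "\<lambda>A. \<Sum>(u, v)\<in>A. 1 / real (u * v)"
  have "?s (?A J) \<le> 4 * real C * real J" for J
  proof (induction J)
    case 0
    have "?A 0 = {}" using squarefree_over_pos by fastforce
    then show ?case by (simp only:) simp
  next
    case (Suc J)
    have fin: "finite (?A J)" for J by (rule finite_squarefree_over_pairs)
    have sub: "?A J \<subseteq> ?A (Suc J)" by (auto simp: power_mult_distrib)
    have split: "?s (?A (Suc J)) = ?s (?A (Suc J) - ?A J) + ?s (?A J)"
      using sum.subset_diff[OF sub fin] .
    \<comment> \<open>The new block has 4^J \<le> u v < 4^(J+1). It contains at most C * 4^(J+1)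
      pairs, each of weight at most 1 / 4^J, and so adds at most 4 C.\<close>
    have "?s (?A (Suc J) - ?A J) \<le> (\<Sum>w\<in>?A (Suc J) - ?A J. 1 / (2 ^ J) ^ 2)"
    proof (rule sum_mono)
      fix w assume w: "w \<in> ?A (Suc J) - ?A J"
      obtain u v where ww: "w = (u, v)" by (cases w) auto
      have "(2 ^ J) ^ 2 \<le> u * v" using w ww by auto
      then have "real ((2 ^ J) ^ 2) \<le> real (u * v)" by (rule of_nat_mono)
      then have "(2 ^ J) ^ 2 \<le> real (u * v)" by simp
      moreover from this have "real (u * v) > 0" by (rule less_le_trans[rotated]) simp
      ultimately have "1 / real (u * v) \<le> 1 / (2 ^ J) ^ 2" by (intro divide_left_mono) simp_all
      then show "(case w of (u, v) \<Rightarrow> 1 / real (u * v)) \<le> 1 / (2 ^ J) ^ 2" by (simp add: ww)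
    qed
    also have "\<dots> = real (card (?A (Suc J) - ?A J)) * (1 / (2 ^ J) ^ 2)" by (rule sum_constant)
    also have "\<dots> \<le> real (C * (2 ^ Suc J) ^ 2) * (1 / (2 ^ J) ^ 2)"
    proof (intro mult_right_mono of_nat_mono)
      have "card (?A (Suc J) - ?A J) \<le> card (?A (Suc J))" by (rule card_mono[OF fin Diff_subset])
      also have "\<dots> \<le> C * (2 ^ Suc J) ^ 2" unfolding C_def by (rule card_split_pairs_le[OF D])
      finally show "card (?A (Suc J) - ?A J) \<le> C * (2 ^ Suc J) ^ 2" .
    qed simp
    also have "\<dots> = 4 * real C" by (simp add: power_mult_distrib)
    finally have "?s (?A (Suc J)) \<le> 4 * real C + 4 * real C * real J" using Suc split by linarith
    then show ?case by (simp only: of_nat_Suc distrib_left mult_1_right)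
  qed
  then show ?thesis by blast
qed

theorem not_summable_nonresidue_primes:
  fixes D :: int
  assumes D: "\<not> is_square D"
  shows "\<not> (\<lambda>p. 1 / real p) summable_on {p. prime p \<and> \<not> QuadRes (int p) D}"
proof
  assume summable: "(\<lambda>p. 1 / real p) summable_on {p. prime p \<and> \<not> QuadRes (int p) D}"
  \<comment> \<open>This set contains every prime outside \<open>split_primes D\<close>; only
    finitely many numbers divide 2 D, so summability persists.\<close>
  let ?Q = "{p. prime p \<and> \<not> QuadRes (int p) D} \<union> {p. int p dvd 2 * D}"
  have "D \<noteq> 0" using D by auto
  have "{p. int p dvd 2 * D} \<subseteq> {..nat \<bar>2 * D\<bar>}"
    using \<open>D \<noteq> 0\<close> dvd_imp_le_int[of "2 * D"] by fastforce
  then have "finite {p. int p dvd 2 * D}" by (rule finite_subset) simp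
  then have Q: "(\<lambda>p. 1 / real p) summable_on ?Q"
    using summable by (intro summable_on_union) auto
  define E where "E = exp (\<Sum>\<^sub>\<infinity>p\<in>?Q. 1 / real p)"
  obtain C where C: "\<And>J. (\<Sum>(u, v)\<in>{(u, v). u * v \<in> squarefree_over (split_primes D) \<and> u * v < (2 ^ J) ^ 2}.
           1 / real (u * v)) \<le> C * real J"
    using sum_split_pairs_le[OF D] by blast
  have bound: "real J \<le> 32 * E ^ 2 * C" if "J > 0" for J
  proof -
    let ?T = "\<Sum>s\<in>{s \<in> squarefree_over (split_primes D). s < 2 ^ J}. 1 / real s"
    have "{p \<in> - split_primes D. prime p \<and> p < 2 ^ J} \<subseteq> ?Q"
    proof safe
      fix p :: nat assume p: "p \<notin> split_primes D" "prime p" "\<not> int p dvd 2 * D" "QuadRes (int p) D"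
      have "int p dvd 2 * D" if "even p"
        using that p primes_dvd_imp_eq[of 2 p] by auto
      then show False using p by (auto simp: split_primes_def)
    qed
    then have "(\<Sum>p\<in>{p \<in> - split_primes D. prime p \<and> p < 2 ^ J}. 1 / real p) \<le> (\<Sum>\<^sub>\<infinity>p\<in>?Q. 1 / real p)"
      by (intro finite_sum_le_infsum[OF Q]) auto
    then have "2 * exp (\<Sum>p\<in>{p \<in> - split_primes D. prime p \<and> p < 2 ^ J}. 1 / real p) * ?T \<le> 2 * E * ?T"
      by (intro mult_right_mono sum_nonneg) (auto simp: E_def)
    then have "real J / 2 \<le> 2 * E * ?T"
      using harmonic_le_squarefree_over[of J "split_primes D"] by linarith
    \<comment> \<open>Squaring lets the bound T^2 \<le> 2 C J enter: J^2 / 4 \<le> 8 E^2 C J, which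
      bounds J.\<close>
    then have "(real J / 2) ^ 2 \<le> (2 * E * ?T) ^ 2"
      by (intro power_mono) auto
    also have "\<dots> = 4 * E ^ 2 * ?T ^ 2" by (simp add: power_mult_distrib)
    also have "\<dots> \<le> 4 * E ^ 2 * (2 * (C * real J))"
      using sum_squarefree_over_square_le[of "split_primes D" "2 ^ J"] C[of J]
      by (intro mult_left_mono) auto
    finally have "real J * real J \<le> (32 * E ^ 2 * C) * real J" by (simp add: power2_eq_square algebra_simps)
    then show ?thesis using that by simp
  qed
  obtain J :: nat where "real J > max 1 (32 * E ^ 2 * C)" using reals_Archimedean2 by blast
  then show False using bound[of J] by simp
qed

subsection \<open>Values of binary quadratic forms\<close>

text \<open>Let D be a nonresidue modulo p and p divide n. The identity 4 a n = (2 a x + b y)^2 - D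
  y^2 forces p to divide y and then x, hence p^2 divides n, and the sieve applies.\<close>

lemma small_binary_form_nonsquare:
  fixes a b c D :: int
  assumes H: "H = UNIV \<or> H = {0..}" and X: "X \<subseteq> H"
    and form: "\<And>n. n \<in> X \<Longrightarrow> \<exists>x y. n = a * x ^ 2 + b * x * y + c * y ^ 2"
    and D: "D = b ^ 2 - 4 * a * c" "\<not> is_square D"
  shows "small H X"
proof (rule small_if_not_summable[OF H X])
  let ?P = "{p. prime p \<and> (\<forall>n\<in>X. int p dvd n \<longrightarrow> int p ^ 2 dvd n)}"
  have "{p. prime p \<and> \<not> QuadRes (int p) D} \<subseteq> ?P"
  proof safe
    fix p n assume p: "prime p" "\<not> QuadRes (int p) D" and n: "n \<in> X" "int p dvd n"
    obtain x y where xy: "n = a * x ^ 2 + b * x * y + c * y ^ 2" using form n by blast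
    have ip: "prime (int p)" using p by simp
    have nr: "\<not> int p dvd z ^ 2 - D" for z using p by (auto simp: QuadRes_iff_dvd)
    have "(2 * a * x + b * y) ^ 2 - D * y ^ 2 = 4 * a * n"
      by (simp add: xy D algebra_simps power2_eq_square)
    then have dvd: "int p dvd (2 * a * x + b * y) ^ 2 - D * y ^ 2" using n by simp
    have py: "int p dvd y"
    proof (rule ccontr)
      \<comment> \<open>Otherwise y has an inverse z modulo p, and multiplying by z^2 exhibits D as
        a square modulo p.\<close>
      assume "\<not> int p dvd y"
      then have "coprime y (int p)" using ip by (metis prime_imp_coprime coprime_commute)
      then obtain z where "[y * z = 1] (mod int p)" using cong_solve_coprime_int by blast
      then have z: "[(y * z) ^ 2 = 1] (mod int p)" by (metis cong_pow power_one)
      have "int p dvd ((2 * a * x + b * y) ^ 2 - D * y ^ 2) * z ^ 2" using dvd by simp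
      moreover have "int p dvd D * ((y * z) ^ 2 - 1)" using z by (simp add: cong_iff_dvd_diff)
      ultimately have "int p dvd ((2 * a * x + b * y) ^ 2 - D * y ^ 2) * z ^ 2 + D * ((y * z) ^ 2 - 1)"
        by (rule dvd_add)
      also have "\<dots> = ((2 * a * x + b * y) * z) ^ 2 - D"
        by (simp add: algebra_simps power2_eq_square)
      finally show False using nr by simp
    qed
    then have "int p dvd D * y ^ 2" by (simp add: power2_eq_square)
    then have "int p dvd (2 * a * x + b * y) ^ 2" using dvd by (metis dvd_diff_left_iff)
    then have "int p dvd 2 * a * x + b * y" using ip prime_dvd_power by blast
    then have "int p dvd 2 * a * x" using py by (metis dvd_add_left_iff dvd_mult)
    \<comment> \<open>If p divided 2 a, then D would be congruent to b^2 modulo p.\<close>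
    moreover have "\<not> int p dvd 2 * a"
    proof
      assume *: "int p dvd 2 * a"
      have "b ^ 2 - D = 2 * a * (2 * c)" by (simp add: D)
      then show False using * nr[of b] by (metis dvd_mult2)
    qed
    ultimately have "int p dvd x" using ip by (metis prime_dvd_mult_iff)
    then have sq: "int p ^ 2 dvd x ^ 2" "int p ^ 2 dvd x * y" "int p ^ 2 dvd y ^ 2"
      using py by (auto simp: power2_eq_square intro: mult_dvd_mono)
    show "int p ^ 2 dvd n"
      unfolding xy mult.assoc by (intro dvd_add sq[THEN dvd_mult])
  qed
  then show "\<not> (\<lambda>p. 1 / real p) summable_on ?P"
    using not_summable_nonresidue_primes[OF D(2)] summable_on_subset_banach by blast
qed

text \<open>Provides a concrete nonsquare to which the divergence theorem applies when D =
  0.\<close>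

lemma not_is_square_2: "\<not> is_square (2 :: int)"
proof
  assume "is_square (2 :: int)"
  then obtain z :: int where z: "2 = z ^ 2" by (auto elim: is_nth_powerE)
  then have "even (z ^ 2)" by presburger
  then have "even z" by simp
  then obtain w where "z = 2 * w" ..
  then have "2 = 4 * w ^ 2" using z by (simp only: power_mult_distrib) simp
  then show False by presburger
qed

text \<open>For vanishing discriminant all primes but finitely many qualify for the sieve; the divergence
  of the sum of their reciprocals is inherited from the nonresidue primes of 2.\<close>
lemma small_multiples_of_squares:
  fixes a :: int
  assumes H: "H = UNIV \<or> H = {0..}" and X: "X \<subseteq> H" and a: "a \<noteq> 0"
    and sq: "\<And>n. n \<in> X \<Longrightarrow> is_square (a * n)"
  shows "small H X"
proof (rule small_if_not_summable[OF H X])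
  let ?P = "{p. prime p \<and> (\<forall>n\<in>X. int p dvd n \<longrightarrow> int p ^ 2 dvd n)}"
  let ?R = "{p. prime p \<and> \<not> QuadRes (int p) 2}"
  have "{p. int p dvd a} \<subseteq> {..nat \<bar>a\<bar>}"
    using a dvd_imp_le_int[of a] by fastforce
  then have fin: "finite {p. int p dvd a}" by (rule finite_subset) simp
  have "?R \<subseteq> ?P \<union> {p. int p dvd a}"
  proof safe
    fix p n assume p: "prime p" "\<not> int p dvd a" and n: "n \<in> X" "int p dvd n"
    have ip: "prime (int p)" using p by simp
    obtain z where z: "a * n = z ^ 2" using sq[OF n(1)] by (auto elim: is_nth_powerE)
    then have "int p dvd z ^ 2" using n by (metis dvd_mult)
    then have "int p dvd z" using ip prime_dvd_power by blast
    then have "int p ^ 2 dvd a * n" unfolding z by simp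
    moreover have "coprime (int p ^ 2) a" using ip p by (simp add: prime_imp_coprime)
    ultimately show "int p ^ 2 dvd n" by (simp add: coprime_dvd_mult_right_iff)
  qed
  moreover have "(\<lambda>p. 1 / real p) summable_on ?P \<union> {p. int p dvd a}" if "(\<lambda>p. 1 / real p) summable_on ?P"
    using that fin by (intro summable_on_union) auto
  ultimately show "\<not> (\<lambda>p. 1 / real p) summable_on ?P"
    using not_summable_nonresidue_primes[OF not_is_square_2] summable_on_subset_banach by blast
qed

text \<open>Completing the square makes 4 a n a square for every value n. If a = 0 then b = 0 as
  well, and c n = (c y)^2.\<close>

lemma small_binary_form_discriminant_0:
  fixes a b c :: int
  assumes H: "H = UNIV \<or> H = {0..}" and X: "X \<subseteq> H"
    and form: "\<And>n. n \<in> X \<Longrightarrow> \<exists>x y. n = a * x ^ 2 + b * x * y + c * y ^ 2"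
    and D: "b ^ 2 - 4 * a * c = 0"
  shows "small H X"
proof (cases "a = 0")
  case False
  show ?thesis
  proof (rule small_multiples_of_squares[OF H X])
    show "4 * a \<noteq> 0" using False by simp
    fix n assume "n \<in> X"
    then obtain x y where n: "n = a * x ^ 2 + b * x * y + c * y ^ 2" using form by blast
    have "4 * a * n = (2 * a * x + b * y) ^ 2 - (b ^ 2 - 4 * a * c) * y ^ 2"
      by (simp add: n algebra_simps power2_eq_square)
    then show "is_square (4 * a * n)" by (simp add: D)
  qed
next
  case True
  then have b: "b = 0" using D by simp
  show ?thesis
  proof (rule small_multiples_of_squares[OF H X])
    \<comment> \<open>For c = 0 the only possible value is 0; the multiplier 1 then keeps the factor
      nonzero.\<close>
    show "(if c = 0 then 1 else c) \<noteq> 0" by simp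
    fix n assume "n \<in> X"
    then obtain y where n: "n = c * y ^ 2" using form True b by auto
    have "c * n = (c * y) ^ 2" by (simp add: n power2_eq_square)
    then show "is_square ((if c = 0 then 1 else c) * n)" using n by auto
  qed
qed

section \<open>Arithmetic progressions among the values\<close>

lemma upper_quasi_density_pos_if_progression:
  assumes \<mu>: "upper_quasi_density UNIV \<mu>" and m: "m \<noteq> 0" and X: "\<And>t. e + m * t \<in> X"
  shows "\<mu> X > 0"
proof (rule upper_quasi_density_pos_if_shifts_cover[OF \<mu>])
  fix n :: int
  \<comment> \<open>The shift carrying the progression onto n; the absolute value allows a negative
    difference m.\<close>
  define h where "h = nat ((n - e) mod \<bar>m\<bar>)"
  have h: "int h = (n - e) mod \<bar>m\<bar>" using m by (simp add: h_def)
  then have "\<bar>m\<bar> dvd n - e - int h" by simp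
  then have "m dvd n - e - int h" by simp
  then obtain t where "n - e - int h = m * t" ..
  then have "n - int h = e + m * t" by simp
  moreover have "h < nat \<bar>m\<bar>" using m by (simp add: h_def nat_less_eq_zless)
  ultimately show "\<exists>h<nat \<bar>m\<bar>. n - int h \<in> X" using X by metis
qed auto

text \<open>The shifts of 0 cover the numbers below the start c of the progression.\<close>
lemma upper_quasi_density_pos_if_progression_nat:
  assumes \<mu>: "upper_quasi_density {0..} \<mu>" and bc: "b > 0" "c \<ge> 0"
    and X: "X \<subseteq> {0..}" "0 \<in> X" "\<And>t. t \<ge> 0 \<Longrightarrow> c + b * t \<in> X"
  shows "\<mu> X > 0"
proof (rule upper_quasi_density_pos_if_shifts_cover[OF \<mu> _ X(1)])
  fix n :: int assume n: "n \<in> {0..}"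
  \<comment> \<open>Shifts below c suffice to reach 0 and shifts below b to reach the progression; b
    + c bounds both.\<close>
  show "\<exists>h<nat (b + c). n - int h \<in> X"
  proof (cases "n < c")
    case True
    then show ?thesis using n bc X(2) by (intro exI[of _ "nat n"]) auto
  next
    case False
    have "n - (n - c) mod b = c + b * ((n - c) div b)"
      using minus_mod_eq_mult_div[of "n - c" b] by simp
    moreover have "(n - c) div b \<ge> 0" using False bc by (simp add: pos_imp_zdiv_nonneg_iff)
    ultimately have "n - (n - c) mod b \<in> X" using X(3) by metis
    moreover have "0 \<le> (n - c) mod b" "(n - c) mod b < b" using bc by auto
    moreover from this have "nat ((n - c) mod b) < nat (b + c)" using bc by linarith
    ultimately show ?thesis by (intro exI[of _ "nat ((n - c) mod b)"]) simp
  qed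
qed auto

text \<open>The values contain a progression whose difference is b if a = 0 and - 2 a d otherwise,
  with D = d^2; it is nonzero because D is.\<close>

lemma binary_form_values_pos:
  fixes a b c D :: int
  assumes \<mu>: "upper_quasi_density UNIV \<mu>" and D: "D = b ^ 2 - 4 * a * c" "D \<noteq> 0" "is_square D"
    and X: "X = {a * x ^ 2 + b * x * y + c * y ^ 2 | x y. True}"
  shows "\<mu> X > 0"
proof (cases "a = 0")
  case True
  show ?thesis
  proof (rule upper_quasi_density_pos_if_progression[OF \<mu>])
    show "b \<noteq> 0" using D True by auto
    show "c + b * t \<in> X" for t
      unfolding X by (intro CollectI exI[of _ t] exI[of _ 1]) (simp add: True)
  qed
next
  case False
  obtain d where d: "D = d ^ 2" using D(3) by (auto elim: is_nth_powerE)
  show ?thesis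
  proof (rule upper_quasi_density_pos_if_progression[OF \<mu>])
    show "- 2 * a * d \<noteq> 0" using False d D(2) by auto
    fix t
    \<comment> \<open>With u = 2ax + (b-d)y and v = 2ax + (b+d)y one has 4a(ax^2 + bxy + cy^2) = uv;
      the line through (1,0) on which u is constant gives an arithmetic progression.\<close>
    have "a * (1 + t * (b - d)) ^ 2 + b * (1 + t * (b - d)) * (- 2 * a * t) + c * (- 2 * a * t) ^ 2
        = a - 2 * a * d * t + a * t ^ 2 * (d ^ 2 - (b ^ 2 - 4 * a * c))"
      by (simp add: algebra_simps power2_eq_square)
    also have "\<dots> = a + - 2 * a * d * t" using D(1) d by simp
    finally show "a + - 2 * a * d * t \<in> X"
      unfolding X by (intro CollectI exI[of _ "1 + t * (b - d)"] exI[of _ "- 2 * a * t"]) simp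
  qed
qed

text \<open>Setting y = 1 if a = 0, and x = 1 if c = 0, gives a progression of difference b. As one
  of a and c vanishes, its start is a + c in both cases.\<close>

lemma binary_form_values_pos_nat:
  fixes a b c :: int
  assumes \<mu>: "upper_quasi_density {0..} \<mu>" and pos: "a \<ge> 0" "b > 0" "c \<ge> 0" and ac: "a * c = 0"
    and X: "X = {a * x ^ 2 + b * x * y + c * y ^ 2 | x y. x \<ge> 0 \<and> y \<ge> 0}"
  shows "\<mu> X > 0"
proof (rule upper_quasi_density_pos_if_progression_nat[OF \<mu> pos(2)])
  show "a + c \<ge> 0" using pos by simp
  show "X \<subseteq> {0..}" using pos by (auto simp: X)
  show "0 \<in> X" unfolding X by (intro CollectI exI[of _ 0]) simp
  show "a + c + b * t \<in> X" if "t \<ge> 0" for t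
  proof (cases "a = 0")
    case True
    then show ?thesis unfolding X using that by (intro CollectI exI[of _ t] exI[of _ 1]) simp
  next
    case False
    then show ?thesis unfolding X using that ac by (intro CollectI exI[of _ 1] exI[of _ t]) simp
  qed
qed

theorem theorem4p2:
  fixes H X :: "int set" and a b c D :: int
  assumes "H = UNIV \<or> H = {0..}"
    and "a \<in> H" and "b \<in> H" and "c \<in> H"
    and "X = {a * x^2 + b * x * y + c * y^2 | x y. x \<in> H \<and> y \<in> H}"
    and "D = b^2 - 4 * a * c"
  shows "(\<not> is_square D \<or> D = 0 \<longrightarrow> small H X) \<and>
         (D \<noteq> 0 \<and> is_square D \<and> (a * c = 0 \<or> H = UNIV) \<longrightarrow>
            (\<forall>\<mu>. upper_quasi_density H \<mu> \<longrightarrow> \<mu> X > 0))"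
proof (intro conjI impI allI)
  have X: "X \<subseteq> H" using assms by auto
  have form: "\<exists>x y. n = a * x ^ 2 + b * x * y + c * y ^ 2" if "n \<in> X" for n
    using that unfolding assms(5) by blast
  show "small H X" if "\<not> is_square D \<or> D = 0"
    using that small_binary_form_nonsquare[OF assms(1) X form assms(6)]
      small_binary_form_discriminant_0[OF assms(1) X form] assms(6) by metis
next
  fix \<mu> assume D: "D \<noteq> 0 \<and> is_square D \<and> (a * c = 0 \<or> H = UNIV)" and \<mu>: "upper_quasi_density H \<mu>"
  show "\<mu> X > 0"
  proof (cases "H = UNIV")
    case True
    then show ?thesis using binary_form_values_pos[of \<mu> D b a c X] \<mu> D assms(5,6) by simp
  next
    case False
    then have H: "H = {0..}" and ac: "a * c = 0" using assms(1) D by auto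
    \<comment> \<open>Since a c = 0, D equals b^2.\<close>
    then have "b \<noteq> 0" using D assms(6) by (auto simp: mult.assoc)
    then show ?thesis using binary_form_values_pos_nat[of \<mu> a b c X] \<mu> assms H ac by simp
  qed
qed

end
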